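(* Let $t(n)$ denote the number of maximal independent sets of the triangular cactus $T(n)$. Then $t(1)=3$, $t(2)=5$, and $t(n)=t(n-1)+t(n-2)$ for all $n\ge 3$.
   Context: For $n\ge 1$, the triangular cactus $T(n)$ is the graph formed by a chain of $n$ triangles $B_1,\dots,B_n$, where for each $1\le i\le n-1$ the consecutive triangles $B_i$ and $B_{i+1}$ share exactly one vertex, non-consecutive triangles share no vertex, and every vertex lies in at most two triangles. An independent set is maximal if no further vertex can be added while keeping it independent. *)

theory Defs
  imports "Graph_Theory.Pair_Digraph"
begin

definition independent_set :: "'a pair_pre_digraph \<Rightarrow> 'a set \<Rightarrow> bool" where
  "independent_set G S \<longleftrightarrow> S \<subseteq> pverts G \<and> (\<forall>u\<in>S. \<forall>v\<in>S. (u, v) \<notin> parcs G)"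

definition maximal_independent_set :: "'a pair_pre_digraph \<Rightarrow> 'a set \<Rightarrow> bool" where
  "maximal_independent_set G S \<longleftrightarrow>
     independent_set G S \<and> (\<forall>v \<in> pverts G - S. \<not> independent_set G (insert v S))"

definition triangular_cactus :: "nat \<Rightarrow> 'a pair_pre_digraph \<Rightarrow> bool" where
  "triangular_cactus n G \<longleftrightarrow> pair_graph G \<and>
     (\<exists>B :: nat \<Rightarrow> 'a set.
        (\<forall>i\<in>{1..n}. card (B i) = 3) \<and>
        pverts G = (\<Union>i\<in>{1..n}. B i) \<and>
        parcs G = (\<Union>i\<in>{1..n}. {(u, v). u \<in> B i \<and> v \<in> B i \<and> u \<noteq> v}) \<and>
        (\<forall>i\<in>{1..<n}. card (B i \<inter> B (Suc i)) = 1) \<and>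
        (\<forall>i\<in>{1..n}. \<forall>j\<in>{1..n}. Suc i < j \<longrightarrow> B i \<inter> B j = {}) \<and>
        (\<forall>v\<in>pverts G. card {i\<in>{1..n}. v \<in> B i} \<le> 2))"

text \<open>
  The description determines the graph only up to isomorphism; the next lemma shows that it is
  satisfiable for every length, with \<open>B i = {2 * i, 2 * i + 1, 2 * i + 2}\<close>.
\<close>

lemma triangular_cactus_exists: "\<exists>G :: nat pair_pre_digraph. triangular_cactus n G"
proof -
  define B :: "nat \<Rightarrow> nat set" where "B = (\<lambda>i. {2 * i, 2 * i + 1, 2 * i + 2})"
  define G :: "nat pair_pre_digraph" where
    "G = \<lparr> pverts = (\<Union>i\<in>{1..n}. B i),
           parcs = (\<Union>i\<in>{1..n}. {(u, v). u \<in> B i \<and> v \<in> B i \<and> u \<noteq> v}) \<rparr>"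
  have fin: "finite (B i)" for i by (simp add: B_def)
  have fin2: "finite {(u, v). u \<in> B i \<and> v \<in> B i \<and> u \<noteq> v}" for i
    by (rule finite_subset[of _ "B i \<times> B i"]) (auto simp: fin)
  have "pair_graph G"
    by unfold_locales (auto simp: G_def fin fin2 symmetric_def intro!: symI)
  moreover have "card (B i) = 3" for i by (simp add: B_def)
  moreover have "card (B i \<inter> B (Suc i)) = 1" for i
  proof -
    have "B i \<inter> B (Suc i) = {2 * i + 2}" by (auto simp: B_def)
    then show ?thesis by simp
  qed
  moreover have "B i \<inter> B j = {}" if "Suc i < j" for i j using that by (auto simp: B_def)
  moreover have "card {i\<in>{1..n}. v \<in> B i} \<le> 2" for v
  proof -
    have "{i\<in>{1..n}. v \<in> B i} \<subseteq> {v div 2, v div 2 - 1}" by (auto simp: B_def)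
    then have "card {i\<in>{1..n}. v \<in> B i} \<le> card {v div 2, v div 2 - 1}"
      by (intro card_mono) auto
    also have "\<dots> \<le> 2" by (simp add: card_insert_if)
    finally show ?thesis .
  qed
  ultimately have "triangular_cactus n G"
    unfolding triangular_cactus_def by (intro conjI exI[of _ B]) (auto simp: G_def)
  then show ?thesis by blast
qed

end

theory Submission
  imports Defs "HOL-Number_Theory.Fib"
begin

text \<open>
  Every triangle of the chain has a vertex lying in no other triangle, and the closed neighbourhood
  of that vertex is the triangle itself. Hence the maximal independent sets are exactly the vertex
  sets that meet every triangle in one vertex. Let \<open>a n\<close> be the number of such transversals, and
  \<open>c n\<close> the number of those through a fixed vertex of the last triangle that is not in the
  preceding one. Splitting by the vertex chosen in triangle \<open>n + 1\<close> gives
  \<open>a (n + 1) = c n + 2 * (a n - c n)\<close> and \<open>c (n + 1) = a n - c n\<close>, so that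
  \<open>a n = fib (n + 3)\<close> and \<open>c n = fib (n + 1)\<close>.
\<close>

definition triangle_chain :: "nat \<Rightarrow> (nat \<Rightarrow> 'a set) \<Rightarrow> bool" where
  "triangle_chain n B \<longleftrightarrow>
     (\<forall>i\<in>{1..n}. card (B i) = 3) \<and>
     (\<forall>i\<in>{1..<n}. card (B i \<inter> B (Suc i)) = 1) \<and>
     (\<forall>i\<in>{1..n}. \<forall>j\<in>{1..n}. Suc i < j \<longrightarrow> B i \<inter> B j = {})"

definition transversals :: "nat \<Rightarrow> (nat \<Rightarrow> 'a set) \<Rightarrow> 'a set set" where
  "transversals n B = {S. S \<subseteq> (\<Union>i\<in>{1..n}. B i) \<and> (\<forall>i\<in>{1..n}. \<exists>!v. v \<in> S \<and> v \<in> B i)}"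

lemma triangle_chain_Suc: "triangle_chain (Suc n) B \<Longrightarrow> triangle_chain n B"
  unfolding triangle_chain_def by auto

lemma triangle_chain_finite: "triangle_chain n B \<Longrightarrow> i \<in> {1..n} \<Longrightarrow> finite (B i)"
  unfolding triangle_chain_def by (metis card.infinite zero_neq_numeral)

lemma triangle_chain_disjoint:
  "triangle_chain n B \<Longrightarrow> i \<ge> 1 \<Longrightarrow> Suc i < j \<Longrightarrow> j \<le> n \<Longrightarrow> B i \<inter> B j = {}"
  unfolding triangle_chain_def by simp

lemma finite_transversals:
  assumes "triangle_chain n B"
  shows "finite (transversals n B)"
proof (rule finite_subset)
  show "transversals n B \<subseteq> Pow (\<Union>i\<in>{1..n}. B i)"
    by (auto simp: transversals_def)
  show "finite (Pow (\<Union>i\<in>{1..n}. B i))"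
    using triangle_chain_finite[OF assms] by simp
qed

lemma card_transversals_eq_sum:
  assumes "triangle_chain n B" "i \<in> {1..n}"
  shows "card (transversals n B) = (\<Sum>v\<in>B i. card {S \<in> transversals n B. v \<in> S})"
proof -
  have unique: "\<exists>!v. v \<in> S \<and> v \<in> B i" if "S \<in> transversals n B" for S
    using assms(2) that unfolding transversals_def by blast
  have "transversals n B = (\<Union>v\<in>B i. {S \<in> transversals n B. v \<in> S})"
    using unique by blast
  also have "card \<dots> = (\<Sum>v\<in>B i. card {S \<in> transversals n B. v \<in> S})"
  proof (rule card_UN_disjoint)
    show "finite (B i)"
      using assms by (rule triangle_chain_finite)
    show "\<forall>v\<in>B i. finite {S \<in> transversals n B. v \<in> S}"
      using finite_transversals[OF assms(1)] by simp
    show "\<forall>v\<in>B i. \<forall>w\<in>B i. v \<noteq> w \<longrightarrow>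
        {S \<in> transversals n B. v \<in> S} \<inter> {S \<in> transversals n B. w \<in> S} = {}"
      using unique by blast
  qed
  finally show ?thesis .
qed

lemma triangle_chain_last_inter:
  assumes "triangle_chain (Suc n) B" "n \<ge> 1" "B n \<inter> B (Suc n) = {x}"
  shows "(\<Union>i\<in>{1..n}. B i) \<inter> B (Suc n) = {x}"
proof -
  have "B i \<inter> B (Suc n) \<subseteq> {x}" if "i \<in> {1..n}" for i
  proof (cases "i = n")
    case True
    then show ?thesis using assms(3) by simp
  next
    case False
    then have "B i \<inter> B (Suc n) = {}"
      using that by (intro triangle_chain_disjoint[OF assms(1)]) auto
    then show ?thesis by simp
  qed
  moreover have "x \<in> B n" "x \<in> B (Suc n)" using assms(3) by auto
  ultimately show ?thesis using assms(2) by fastforce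
qed

lemma transversals_Suc_iff:
  "S \<in> transversals (Suc n) B \<longleftrightarrow>
     S \<subseteq> (\<Union>i\<in>{1..n}. B i) \<union> B (Suc n) \<and>
     (\<forall>i\<in>{1..n}. \<exists>!v. v \<in> S \<and> v \<in> B i) \<and> (\<exists>!v. v \<in> S \<and> v \<in> B (Suc n))"
proof -
  have "{1..Suc n} = insert (Suc n) {1..n}" by auto
  then show ?thesis
    unfolding transversals_def mem_Collect_eq
    by (simp only: UN_insert ball_simps Un_commute conj_commute)
qed

lemma transversals_Suc_shared:
  assumes "(\<Union>i\<in>{1..n}. B i) \<inter> B (Suc n) = {x}"
  shows "{S \<in> transversals (Suc n) B. x \<in> S} = {S \<in> transversals n B. x \<in> S}"
proof -
  have range: "(S \<subseteq> (\<Union>i\<in>{1..n}. B i) \<union> B (Suc n) \<and> (\<exists>!v. v \<in> S \<and> v \<in> B (Suc n)))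
      = (S \<subseteq> (\<Union>i\<in>{1..n}. B i))" (is "?l = ?r") if "x \<in> S" for S
  proof
    have x: "x \<in> B (Suc n)" "x \<in> (\<Union>i\<in>{1..n}. B i)" using assms by auto
    assume ?l
    then have "v = x" if "v \<in> S" "v \<in> B (Suc n)" for v
      using x(1) \<open>x \<in> S\<close> that by blast
    then show ?r using \<open>?l\<close> x(2) by blast
  next
    assume ?r
    then have "S \<inter> B (Suc n) = {x}" using assms \<open>x \<in> S\<close> by blast
    then have "v \<in> S \<and> v \<in> B (Suc n) \<longleftrightarrow> v = x" for v by blast
    then show ?l using \<open>?r\<close> by auto
  qed
  have "S \<in> transversals (Suc n) B \<longleftrightarrow> S \<in> transversals n B" if "x \<in> S" for S
    unfolding transversals_Suc_iff
    unfolding transversals_def mem_Collect_eq range[OF that, symmetric]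
    by (simp only: conj_ac)
  then show ?thesis by blast
qed

lemma transversals_Suc_unshared:
  assumes "(\<Union>i\<in>{1..n}. B i) \<inter> B (Suc n) = {x}" "y \<in> B (Suc n)" "y \<noteq> x"
  shows "{S \<in> transversals (Suc n) B. y \<in> S} = insert y ` {S \<in> transversals n B. x \<notin> S}"
proof (intro equalityI subsetI)
  have y: "y \<notin> B i" if "i \<in> {1..n}" for i using assms that by blast
  fix S
  {
    assume "S \<in> {S \<in> transversals (Suc n) B. y \<in> S}"
    then have S: "S \<subseteq> (\<Union>i\<in>{1..n}. B i) \<union> B (Suc n)" "y \<in> S"
      "\<And>i. i \<in> {1..n} \<Longrightarrow> \<exists>!v. v \<in> S \<and> v \<in> B i" "\<exists>!v. v \<in> S \<and> v \<in> B (Suc n)"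
      unfolding transversals_Suc_iff by blast+
    have only_y: "v = y" if "v \<in> S" "v \<in> B (Suc n)" for v using S(2,4) assms(2) that by blast
    have "\<exists>!v. v \<in> S - {y} \<and> v \<in> B i" if "i \<in> {1..n}" for i
    proof -
      have "(v \<in> S - {y} \<and> v \<in> B i) = (v \<in> S \<and> v \<in> B i)" for v using y[OF that] by auto
      then show ?thesis using S(3)[OF that] by simp
    qed
    moreover have "S - {y} \<subseteq> (\<Union>i\<in>{1..n}. B i)" using S(1) only_y by blast
    moreover have "x \<notin> S - {y}" using only_y assms by blast
    ultimately have "S - {y} \<in> {S \<in> transversals n B. x \<notin> S}"
      unfolding transversals_def by blast
    moreover have "S = insert y (S - {y})" using S(2) by blast
    ultimately show "S \<in> insert y ` {S \<in> transversals n B. x \<notin> S}" by blast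
  next
    assume "S \<in> insert y ` {S \<in> transversals n B. x \<notin> S}"
    then obtain R where "S = insert y R" "x \<notin> R" "R \<in> transversals n B" by blast
    then have R: "S = insert y R" "R \<subseteq> (\<Union>i\<in>{1..n}. B i)" "x \<notin> R"
      "\<And>i. i \<in> {1..n} \<Longrightarrow> \<exists>!v. v \<in> R \<and> v \<in> B i"
      unfolding transversals_def by simp_all
    have "\<exists>!v. v \<in> S \<and> v \<in> B i" if "i \<in> {1..n}" for i
    proof -
      have "(v \<in> S \<and> v \<in> B i) = (v \<in> R \<and> v \<in> B i)" for v using y[OF that] R(1) by auto
      then show ?thesis using R(4)[OF that] by simp
    qed
    moreover have "\<exists>!v. v \<in> S \<and> v \<in> B (Suc n)"
    proof -
      have "R \<inter> B (Suc n) \<subseteq> {x}" unfolding assms(1)[symmetric] using R(2) by (rule Int_mono) simp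
      then have "R \<inter> B (Suc n) = {}" using R(3) by blast
      then have "v \<in> S \<and> v \<in> B (Suc n) \<longleftrightarrow> v = y" for v using R(1) assms(2) by blast
      then show ?thesis by simp
    qed
    moreover have "S \<subseteq> (\<Union>i\<in>{1..n}. B i) \<union> B (Suc n)" using R(1,2) assms(2) by auto
    ultimately show "S \<in> {S \<in> transversals (Suc n) B. y \<in> S}"
      by (simp add: transversals_Suc_iff R(1))
  }
qed

lemma card_transversals:
  assumes "n \<ge> 1" "triangle_chain n B"
  shows "card (transversals n B) = fib (n + 3) \<and>
    (\<forall>v\<in>B n. n = 1 \<or> v \<notin> B (n - 1) \<longrightarrow> card {S \<in> transversals n B. v \<in> S} = fib (n + 1))"
  using assms
proof (induction n rule: nat_induct_at_least)
  case base
  have through: "{S \<in> transversals 1 B. v \<in> S} = {{v}}" if "v \<in> B 1" for v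
    using that by (auto simp: transversals_def)
  moreover have "card (B 1) = 3" using base by (simp add: triangle_chain_def)
  ultimately have "card (transversals 1 B) = 3"
    using card_transversals_eq_sum[OF base, of 1] by simp
  then show ?case using through by (simp add: eval_nat_numeral)
next
  case (Suc n)
  let ?U = "\<Union>i\<in>{1..n}. B i"
  have "card (B n \<inter> B (Suc n)) = 1"
    using Suc.hyps Suc.prems unfolding triangle_chain_def by simp
  then obtain x where x: "B n \<inter> B (Suc n) = {x}"
    by (rule card_1_singletonE)
  have chain: "triangle_chain n B" using Suc.prems by (rule triangle_chain_Suc)
  note U = triangle_chain_last_inter[OF Suc.prems Suc.hyps x]
  have "n = 1 \<or> x \<notin> B (n - 1)"
  proof (cases "n = 1")
    case False
    then have "B (n - 1) \<inter> B (Suc n) = {}"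
      using Suc.hyps by (intro triangle_chain_disjoint[OF Suc.prems]) auto
    then show ?thesis using x by auto
  qed simp
  then have cx: "card {S \<in> transversals n B. x \<in> S} = fib (n + 1)"
    and a: "card (transversals n B) = fib (n + 3)"
    using Suc.IH[OF chain] x by auto
  have "card {S \<in> transversals n B. x \<notin> S} = card (transversals n B - {S \<in> transversals n B. x \<in> S})"
    by (rule arg_cong[of _ _ card]) auto
  also have "\<dots> = fib (n + 3) - fib (n + 1)"
    using a cx finite_transversals[OF chain] by (subst card_Diff_subset) auto
  also have "\<dots> = fib (n + 2)" by (simp add: eval_nat_numeral)
  finally have avoid: "card {S \<in> transversals n B. x \<notin> S} = fib (n + 2)" .
  have unshared: "card {S \<in> transversals (Suc n) B. y \<in> S} = fib (n + 2)"
    if "y \<in> B (Suc n)" "y \<noteq> x" for y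
  proof -
    have "y \<notin> ?U" using U that by blast
    then have "y \<notin> S" if "S \<in> transversals n B" for S
      using that by (auto simp: transversals_def)
    then have "inj_on (insert y) {S \<in> transversals n B. x \<notin> S}"
      by (intro inj_onI) (simp add: insert_ident)
    then show ?thesis
      unfolding transversals_Suc_unshared[OF U that] by (simp add: card_image avoid)
  qed
  have fin: "finite (B (Suc n))" and x_in: "x \<in> B (Suc n)" and three: "card (B (Suc n)) = 3"
    using Suc.prems triangle_chain_finite[OF Suc.prems] x by (auto simp: triangle_chain_def)
  have "card (transversals (Suc n) B) =
      (\<Sum>v\<in>B (Suc n). card {S \<in> transversals (Suc n) B. v \<in> S})"
    using Suc.prems by (rule card_transversals_eq_sum) simp
  also have "\<dots> = fib (n + 1) + (\<Sum>v\<in>B (Suc n) - {x}. fib (n + 2))"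
    unfolding sum.remove[OF fin x_in] transversals_Suc_shared[OF U] cx
    using unshared by (intro arg_cong2[of _ _ _ _ "(+)"] sum.cong) auto
  also have "\<dots> = fib (Suc n + 3)"
    using fin x_in three by (simp add: eval_nat_numeral)
  finally have "card (transversals (Suc n) B) = fib (Suc n + 3)" .
  moreover have "card {S \<in> transversals (Suc n) B. v \<in> S} = fib (Suc n + 1)"
    if "v \<in> B (Suc n)" "v \<notin> B n" for v
    using unshared[of v] that x by auto
  ultimately show ?case using Suc.hyps by simp
qed

lemma triangle_chain_private_vertex:
  assumes "triangle_chain n B" "i \<in> {1..n}"
  obtains d where "d \<in> B i" "\<And>j. j \<in> {1..n} \<Longrightarrow> d \<in> B j \<Longrightarrow> j = i"
proof -
  define L where "L = (if i = 1 then {} else B (i - 1) \<inter> B i)"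
  define R where "R = (if i = n then {} else B i \<inter> B (Suc i))"
  have "card L \<le> 1"
  proof (cases "i = 1")
    case False
    then have "i - 1 \<in> {1..<n}" "Suc (i - 1) = i" using assms(2) by auto
    then have "card (B (i - 1) \<inter> B i) = 1"
      using assms(1) unfolding triangle_chain_def by metis
    then show ?thesis by (simp add: L_def)
  qed (simp add: L_def)
  moreover have "card R \<le> 1" using assms unfolding triangle_chain_def R_def by auto
  ultimately have "card (L \<union> R) < card (B i)"
    using card_Un_le[of L R] assms unfolding triangle_chain_def by fastforce
  moreover have "finite (L \<union> R)"
    using triangle_chain_finite[OF assms] by (auto simp: L_def R_def)
  ultimately obtain d where d: "d \<in> B i" "d \<notin> L \<union> R"
    by (meson card_mono leD subsetI)
  have "j = i" if j: "j \<in> {1..n}" "d \<in> B j" for j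
  proof (rule ccontr)
    assume "j \<noteq> i"
    then consider "Suc j < i" | "j = i - 1" "i \<noteq> 1" | "j = Suc i" | "Suc i < j"
      using j(1) assms(2) by fastforce
    then show False
    proof cases
      case 1
      then show False using triangle_chain_disjoint[OF assms(1), of j i] assms(2) d(1) j by auto
    next
      case 2
      then show False using d j(2) by (simp add: L_def)
    next
      case 3
      then show False using assms(2) d j by (auto simp: R_def)
    next
      case 4
      then show False using triangle_chain_disjoint[OF assms(1), of i j] assms(2) d(1) j by auto
    qed
  qed
  then show thesis using d(1) that by blast
qed

lemma maximal_independent_sets_eq_transversals:
  assumes chain: "triangle_chain n B"
    and V: "pverts G = (\<Union>i\<in>{1..n}. B i)"
    and E: "parcs G = (\<Union>i\<in>{1..n}. {(u, v). u \<in> B i \<and> v \<in> B i \<and> u \<noteq> v})"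
  shows "{S. maximal_independent_set G S} = transversals n B"
proof (intro equalityI subsetI)
  have indep: "independent_set G S \<longleftrightarrow> S \<subseteq> (\<Union>i\<in>{1..n}. B i) \<and>
      (\<forall>i\<in>{1..n}. \<forall>u v. u \<in> S \<longrightarrow> v \<in> S \<longrightarrow> u \<in> B i \<longrightarrow> v \<in> B i \<longrightarrow> u = v)" for S
    unfolding independent_set_def V E by blast
  fix S
  {
    assume "S \<in> {S. maximal_independent_set G S}"
    then have S: "independent_set G S"
      "\<And>v. v \<in> pverts G \<Longrightarrow> v \<notin> S \<Longrightarrow> \<not> independent_set G (insert v S)"
      by (auto simp: maximal_independent_set_def)
    have "\<exists>v. v \<in> S \<and> v \<in> B i" if i: "i \<in> {1..n}" for i
    proof (rule ccontr)
      assume no: "\<nexists>v. v \<in> S \<and> v \<in> B i"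
      obtain d where d: "d \<in> B i" "\<And>j. j \<in> {1..n} \<Longrightarrow> d \<in> B j \<Longrightarrow> j = i"
        using triangle_chain_private_vertex[OF chain i] by blast
      have "u = v" if "j \<in> {1..n}" "u \<in> insert d S" "v \<in> insert d S" "u \<in> B j" "v \<in> B j" for j u v
        using that no d S(1) unfolding indep by (metis insertE)
      moreover have "insert d S \<subseteq> (\<Union>i\<in>{1..n}. B i)" using d(1) i S(1) unfolding indep by auto
      ultimately have "independent_set G (insert d S)" unfolding indep by blast
      then show False using S(2)[of d] d(1) i no V by blast
    qed
    then show "S \<in> transversals n B" using S(1) unfolding indep transversals_def by blast
  next
    assume S: "S \<in> transversals n B"
    then have "independent_set G S" unfolding indep transversals_def by blast
    moreover have "\<not> independent_set G (insert v S)" if v: "v \<in> pverts G - S" for v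
    proof
      assume ind: "independent_set G (insert v S)"
      obtain i where i: "i \<in> {1..n}" "v \<in> B i" using v V by blast
      then obtain s where "s \<in> S" "s \<in> B i" using S unfolding transversals_def by blast
      then show False using ind i v unfolding indep by blast
    qed
    ultimately show "S \<in> {S. maximal_independent_set G S}"
      unfolding maximal_independent_set_def by blast
  }
qed

lemma card_maximal_independent_sets_triangular_cactus:
  assumes "triangular_cactus n G" "n \<ge> 1"
  shows "card {S. maximal_independent_set G S} = fib (n + 3)"
proof -
  obtain B where B: "triangle_chain n B" "pverts G = (\<Union>i\<in>{1..n}. B i)"
    "parcs G = (\<Union>i\<in>{1..n}. {(u, v). u \<in> B i \<and> v \<in> B i \<and> u \<noteq> v})"
    using assms(1) unfolding triangular_cactus_def triangle_chain_def by blast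
  show ?thesis
    using maximal_independent_sets_eq_transversals[OF B] card_transversals[OF assms(2) B(1)] by simp
qed

theorem theorem2p2:
  fixes T :: "nat \<Rightarrow> 'a pair_pre_digraph" and t :: "nat \<Rightarrow> nat"
  assumes "\<And>n. n \<ge> 1 \<Longrightarrow> triangular_cactus n (T n)"
    and "\<And>n. n \<ge> 1 \<Longrightarrow> t n = card {S. maximal_independent_set (T n) S}"
  shows "t 1 = 3 \<and> t 2 = 5 \<and> (\<forall>n\<ge>3. t n = t (n - 1) + t (n - 2))"
proof -
  have t: "t n = fib (n + 3)" if "n \<ge> 1" for n
    using assms that card_maximal_independent_sets_triangular_cactus by metis
  have "t n = t (n - 1) + t (n - 2)" if "n \<ge> 3" for n
  proof -
    have "n - 1 + 3 = n + 2" "n - 2 + 3 = n + 1" using that by auto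
    then show ?thesis using that by (simp add: t numeral_3_eq_3 del: One_nat_def)
  qed
  moreover have "t 1 = 3" "t 2 = 5" by (simp_all add: t eval_nat_numeral)
  ultimately show ?thesis by blast
qed

end
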